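(* Consider the standard model of floating point arithmetic satisfying the IEEE 754 standard, with set of floating point numbers $\mathbb{F}$. Let $$A=PTP^T,\qquad v=\widetilde\gamma_1Pe_1,\qquad w=\widetilde\beta_1Pe_1,$$ where $P\in\mathbb{F}^{n\times n}$ is a signed permutation matrix, $\widetilde\gamma_1,\widetilde\beta_1\in\mathbb{F}$, and $T\in\mathbb{F}^{n\times n}$ is tridiagonal of the form $$T=\begin{bmatrix}\widetilde\alpha_1 & \widetilde\beta_2\\ \widetilde\gamma_2 & \ddots & \ddots\\ & \ddots & \ddots & \widetilde\beta_n\\ & & \widetilde\gamma_n & \widetilde\alpha_n\end{bmatrix},$$ with $\widetilde\beta_j\neq0$, $\widetilde\gamma_j>0$ and $\widetilde\gamma_j^2$ within the exponent range, $j=1,\dots,n$. Then the nonsymmetric Lanczos algorithm applied to $A$, $v$ and $w$ in floating point arithmetic computes exactly. As a consequence, $T_n=T$, where $T_n$ is the tridiagonal matrix of the computed coefficients.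
   Context: **Floating point arithmetic.** $\mathbb{F}$ is the set of floating point numbers of an IEEE 754 binary format (e.g. binary64, binary32, binary16), with rounding to nearest. For $\alpha,\beta\in\mathbb{F}$ and a basic operation $\circ$ (addition, subtraction, multiplication, division; similarly the square root), $\mathrm{fl}(\alpha\circ\beta)$ is the floating point number nearest to the exact value; if the exact value is within the exponent range (no overflow or underflow), then $\mathrm{fl}(\alpha\circ\beta)=(\alpha\circ\beta)(1+\delta)$ with $|\delta|\le\mathbf{u}$, where $\mathbf{u}$ is the unit roundoff. A positive real number is within the exponent range if it lies between the smallest positive normalized and the largest finite floating point number. Inner products and matrix-vector products are evaluated as floating point sums of floating point products; the Euclidean norm $\|z\|$ is evaluated as the floating point square root of the floating point sum of the floating point squares of the entries. Signed zeros are identified. **Signed permutation matrix.** A permutation matrix in which the entries $1$ are replaced by $\pm1$. **Nonsymmetric Lanczos algorithm** (input: $A\in\mathbb{R}^{n\times n}$, vectors $v,w$ with $w^Tv\ne0$). Set $v_0=w_0=0$, $\gamma_1=\|v\|$, $v_1=v/\gamma_1$, $\beta_1=w^Tv_1$, $w_1=w/\beta_1$. For $i=1,\dots,n$: $\alpha_i=w_i^TAv_i$; $v=Av_i-\alpha_iv_i-\beta_iv_{i-1}$; $\gamma_{i+1}=\|v\|$; $v_{i+1}=v/\gamma_{i+1}$; $w=A^Tw_i-\alpha_iw_i-\gamma_iw_{i-1}$; $\beta_{i+1}=v_{i+1}^Tw$; $w_{i+1}=w/\beta_{i+1}$ (the algorithm stops when $\gamma_{i+1}=0$). $T_k$ is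 the $k\times k$ tridiagonal matrix with diagonal $\alpha_1,\dots,\alpha_k$, subdiagonal $\gamma_2,\dots,\gamma_k$ and superdiagonal $\beta_2,\dots,\beta_k$. **Computes exactly.** Every vector and coefficient assigned in the lines of the algorithm, when computed in floating point arithmetic, coincides with the corresponding quantity produced by the algorithm in exact arithmetic. *)

theory Defs
  imports
    Complex_Main
    "HOL-Combinatorics.Permutations"
    "Jordan_Normal_Form.Matrix"
begin

section \<open>Binary floating point formats\<close>

text \<open>
  A binary format is given by its precision \<open>p\<close> (number of significand bits, including the leading
  one) and its maximal exponent \<open>emax\<close>; the minimal exponent is \<open>1 - emax\<close>, as IEEE 754 prescribes.
  Thus binary16, binary32 and binary64 are \<open>(11, 15)\<close>, \<open>(24, 127)\<close> and \<open>(53, 1023)\<close>.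
\<close>

definition binary_format :: "nat \<Rightarrow> int \<Rightarrow> bool" where
  "binary_format p emax \<longleftrightarrow> 2 \<le> p \<and> 1 \<le> emax"

text \<open>
  The finite floating point numbers, as real numbers (so the two signed zeros are identified).
  Subnormal numbers are those with \<open>e = 1 - emax\<close> and \<open>\<bar>m\<bar> < 2 ^ (p - 1)\<close>.
\<close>

definition floats :: "nat \<Rightarrow> int \<Rightarrow> real set" where
  "floats p emax = {of_int m * 2 powi (e - int p + 1) | m e :: int.
     \<bar>m\<bar> < 2 ^ p \<and> 1 - emax \<le> e \<and> e \<le> emax}"

definition min_normal :: "int \<Rightarrow> real" where
  "min_normal emax = 2 powi (1 - emax)"

definition max_float :: "nat \<Rightarrow> int \<Rightarrow> real" where
  "max_float p emax = (2 - 2 powi (1 - int p)) * 2 powi emax"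

definition within_exponent_range :: "nat \<Rightarrow> int \<Rightarrow> real \<Rightarrow> bool" where
  "within_exponent_range p emax x \<longleftrightarrow> min_normal emax \<le> x \<and> x \<le> max_float p emax"

text \<open>IEEE 754 rounding to nearest overflows from \<open>max_float\<close> plus half a unit in the last place on.\<close>

definition overflow_threshold :: "nat \<Rightarrow> int \<Rightarrow> real" where
  "overflow_threshold p emax = (2 - 2 powi (- int p)) * 2 powi emax"

definition nearest_in :: "real set \<Rightarrow> real \<Rightarrow> real \<Rightarrow> bool" where
  "nearest_in F x y \<longleftrightarrow> y \<in> F \<and> (\<forall>z\<in>F. \<bar>x - y\<bar> \<le> \<bar>x - z\<bar>)"

text \<open>
  The result of an operation is \<open>Some x\<close> for a number \<open>x\<close>, and \<open>None\<close> when it is not a number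
  (an infinity or a NaN in IEEE 754).  Ties may be broken in any way.
\<close>

type_synonym val = "real option"

definition round_to_nearest :: "nat \<Rightarrow> int \<Rightarrow> (real \<Rightarrow> val) \<Rightarrow> bool" where
  "round_to_nearest p emax fl \<longleftrightarrow>
     (\<forall>x. if \<bar>x\<bar> < overflow_threshold p emax
          then \<exists>y. fl x = Some y \<and> nearest_in (floats p emax) x y
          else fl x = None)"

section \<open>Arithmetic with a rounding function\<close>

text \<open>
  All operations depend on a rounding function \<open>fl\<close> that is applied to the exact result of every
  scalar operation.  Floating point arithmetic is obtained from an \<open>fl\<close> with
  \<open>round_to_nearest p emax fl\<close>, and exact arithmetic from \<open>fl = Some\<close>.
\<close>

definition lift2 :: "(real \<Rightarrow> real \<Rightarrow> val) \<Rightarrow> val \<Rightarrow> val \<Rightarrow> val" where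
  "lift2 f x y = Option.bind x (\<lambda>a. Option.bind y (\<lambda>b. f a b))"

definition add_op :: "(real \<Rightarrow> val) \<Rightarrow> val \<Rightarrow> val \<Rightarrow> val" where
  "add_op fl = lift2 (\<lambda>a b. fl (a + b))"

definition sub_op :: "(real \<Rightarrow> val) \<Rightarrow> val \<Rightarrow> val \<Rightarrow> val" where
  "sub_op fl = lift2 (\<lambda>a b. fl (a - b))"

definition mul_op :: "(real \<Rightarrow> val) \<Rightarrow> val \<Rightarrow> val \<Rightarrow> val" where
  "mul_op fl = lift2 (\<lambda>a b. fl (a * b))"

definition div_op :: "(real \<Rightarrow> val) \<Rightarrow> val \<Rightarrow> val \<Rightarrow> val" where
  "div_op fl = lift2 (\<lambda>a b. if b = 0 then None else fl (a / b))"

definition sqrt_op :: "(real \<Rightarrow> val) \<Rightarrow> val \<Rightarrow> val" where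
  "sqrt_op fl x = Option.bind x (\<lambda>a. if a < 0 then None else fl (sqrt a))"

text \<open>
  The order in which the terms of a sum are added is not prescribed.  It is given by a binary tree
  whose leaves are the positions of the terms, each occurring once; the function
  \<open>ord\<close> chooses such a tree for each vector of terms.
\<close>

datatype sum_tree = Term nat | Plus sum_tree sum_tree

fun positions :: "sum_tree \<Rightarrow> nat list" where
  "positions (Term i) = [i]"
| "positions (Plus s t) = positions s @ positions t"

fun sum_along :: "(real \<Rightarrow> val) \<Rightarrow> sum_tree \<Rightarrow> val vec \<Rightarrow> val" where
  "sum_along fl (Term i) x = x $ i"
| "sum_along fl (Plus s t) x = add_op fl (sum_along fl s x) (sum_along fl t x)"

definition summation_order :: "(val vec \<Rightarrow> sum_tree) \<Rightarrow> bool" where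
  "summation_order ord \<longleftrightarrow> (\<forall>x. 0 < dim_vec x \<longrightarrow>
     distinct (positions (ord x)) \<and> set (positions (ord x)) = {..<dim_vec x})"

type_synonym arith = "(real \<Rightarrow> val) \<times> (val vec \<Rightarrow> sum_tree)"

fun dot :: "arith \<Rightarrow> val vec \<Rightarrow> val vec \<Rightarrow> val" where
  "dot (fl, ord) x y =
     (let t = vec (dim_vec y) (\<lambda>k. mul_op fl (x $ k) (y $ k)) in sum_along fl (ord t) t)"

fun norm2 :: "arith \<Rightarrow> val vec \<Rightarrow> val" where
  "norm2 (fl, ord) x = sqrt_op fl (dot (fl, ord) x x)"

definition mat_vec :: "arith \<Rightarrow> val mat \<Rightarrow> val vec \<Rightarrow> val vec" where
  "mat_vec ar A x = vec (dim_row A) (\<lambda>k. dot ar (row A k) x)"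

fun scale :: "arith \<Rightarrow> val \<Rightarrow> val vec \<Rightarrow> val vec" where
  "scale (fl, ord) c x = map_vec (\<lambda>a. mul_op fl c a) x"

fun divide_by :: "arith \<Rightarrow> val vec \<Rightarrow> val \<Rightarrow> val vec" where
  "divide_by (fl, ord) x c = map_vec (\<lambda>a. div_op fl a c) x"

fun sub_vec :: "arith \<Rightarrow> val vec \<Rightarrow> val vec \<Rightarrow> val vec" where
  "sub_vec (fl, ord) x y = vec (dim_vec x) (\<lambda>k. sub_op fl (x $ k) (y $ k))"

text \<open>For \<open>fl = Some\<close> these are the usual operations.\<close>

lemma sum_along_exact:
  assumes "distinct (positions t)" "set (positions t) \<subseteq> {..<n}"
  shows "sum_along Some t (vec n (\<lambda>k. Some (f k))) = Some (\<Sum>k\<in>set (positions t). f k)"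
  using assms
  by (induction t) (auto simp: add_op_def lift2_def sum.union_disjoint)

lemma dot_exact:
  assumes "summation_order ord" "0 < dim_vec y" "dim_vec x = dim_vec y"
  shows "dot (Some, ord) (map_vec Some x) (map_vec Some y) = Some (x \<bullet> y)"
proof -
  define t where "t = vec (dim_vec y) (\<lambda>k. Some (x $ k * y $ k))"
  have *: "vec (dim_vec (map_vec Some y))
      (\<lambda>k. mul_op Some (map_vec Some x $ k) (map_vec Some y $ k)) = t"
    using assms by (auto simp: t_def mul_op_def lift2_def)
  have o: "distinct (positions (ord t))" "set (positions (ord t)) = {..<dim_vec y}"
    using assms(1,2) unfolding summation_order_def by (auto simp: t_def)
  have "sum_along Some (ord t) t = Some (\<Sum>k\<in>set (positions (ord t)). x $ k * y $ k)"
    using sum_along_exact[OF o(1), of "dim_vec y" "\<lambda>k. x $ k * y $ k"] o(2)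
    by (simp flip: t_def)
  then show ?thesis
    using o(2) by (simp only: dot.simps * Let_def) (simp add: scalar_prod_def lessThan_atLeast0)
qed

lemma norm2_exact:
  assumes "summation_order ord" "0 < dim_vec x"
  shows "norm2 (Some, ord) (map_vec Some x) = Some (sqrt (x \<bullet> x))"
proof -
  have "\<not> x \<bullet> x < 0"
    by (auto simp: scalar_prod_def not_less intro!: sum_nonneg)
  then show ?thesis
    by (simp only: norm2.simps dot_exact[OF assms refl]) (simp add: sqrt_op_def)
qed

lemma mat_vec_exact:
  assumes "summation_order ord" "0 < dim_vec x" "dim_col A = dim_vec x"
  shows "mat_vec (Some, ord) (map_mat Some A) (map_vec Some x) = map_vec Some (A *\<^sub>v x)"
proof -
  have "row (map_mat Some A) k = map_vec Some (row A k)" if "k < dim_row A" for k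
    using that by auto
  then show ?thesis
    using assms by (auto simp: mat_vec_def dot_exact simp del: dot.simps)
qed

section \<open>The nonsymmetric Lanczos algorithm\<close>

text \<open>
  \<open>lanczos ar A v w i\<close> contains the values after pass \<open>i\<close> of the loop (for \<open>i = 0\<close>: after the
  initialization).  Its fields \<open>coef_gamma\<close>, \<open>coef_beta\<close>, \<open>vec_v\<close>, \<open>vec_w\<close> are
  \<open>\<gamma>\<close>, \<open>\<beta>\<close>, \<open>v\<close>, \<open>w\<close> with index \<open>i + 1\<close>, \<open>prev_v\<close> and \<open>prev_w\<close> are
  \<open>v\<close> and \<open>w\<close> with index \<open>i\<close>, \<open>coef_alpha\<close> is \<open>\<alpha>\<close> with index \<open>i\<close> (meaningless
  for \<open>i = 0\<close>), and \<open>raw_v\<close> and \<open>raw_w\<close> are the program variables \<open>v\<close> and \<open>w\<close> without index.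

  The function continues after the algorithm has stopped; which passes the algorithm executes
  is determined by \<open>executed\<close> below.
\<close>

record lanczos_state =
  coef_alpha :: val
  raw_v :: "val vec"
  coef_gamma :: val
  vec_v :: "val vec"
  raw_w :: "val vec"
  coef_beta :: val
  vec_w :: "val vec"
  prev_v :: "val vec"
  prev_w :: "val vec"

definition lanczos_init :: "arith \<Rightarrow> val vec \<Rightarrow> val vec \<Rightarrow> lanczos_state" where
  "lanczos_init ar v w =
     (let \<gamma> = norm2 ar v;
          v1 = divide_by ar v \<gamma>;
          \<beta> = dot ar w v1;
          w1 = divide_by ar w \<beta>;
          z = vec (dim_vec v) (\<lambda>_. Some 0)
      in \<lparr>coef_alpha = None, raw_v = v, coef_gamma = \<gamma>, vec_v = v1,
          raw_w = w, coef_beta = \<beta>, vec_w = w1, prev_v = z, prev_w = z\<rparr>)"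

definition lanczos_pass :: "arith \<Rightarrow> val mat \<Rightarrow> lanczos_state \<Rightarrow> lanczos_state" where
  "lanczos_pass ar A s =
     (let Av = mat_vec ar A (vec_v s);
          \<alpha> = dot ar (vec_w s) Av;
          v = sub_vec ar (sub_vec ar Av (scale ar \<alpha> (vec_v s))) (scale ar (coef_beta s) (prev_v s));
          \<gamma> = norm2 ar v;
          v' = divide_by ar v \<gamma>;
          Aw = mat_vec ar (transpose_mat A) (vec_w s);
          w = sub_vec ar (sub_vec ar Aw (scale ar \<alpha> (vec_w s))) (scale ar (coef_gamma s) (prev_w s));
          \<beta> = dot ar v' w;
          w' = divide_by ar w \<beta>
      in \<lparr>coef_alpha = \<alpha>, raw_v = v, coef_gamma = \<gamma>, vec_v = v',
          raw_w = w, coef_beta = \<beta>, vec_w = w', prev_v = vec_v s, prev_w = vec_w s\<rparr>)"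

primrec lanczos :: "arith \<Rightarrow> real mat \<Rightarrow> real vec \<Rightarrow> real vec \<Rightarrow> nat \<Rightarrow> lanczos_state" where
  "lanczos ar A v w 0 = lanczos_init ar (map_vec Some v) (map_vec Some w)"
| "lanczos ar A v w (Suc i) = lanczos_pass ar (map_mat Some A) (lanczos ar A v w i)"

text \<open>Pass \<open>i\<close> is executed unless \<open>\<gamma> = 0\<close> has stopped the algorithm in an earlier pass.\<close>

definition executed :: "arith \<Rightarrow> real mat \<Rightarrow> real vec \<Rightarrow> real vec \<Rightarrow> nat \<Rightarrow> bool" where
  "executed ar A v w i \<longleftrightarrow> 1 \<le> i \<and> i \<le> dim_row A \<and>
     (\<forall>j\<in>{1..<i}. coef_gamma (lanczos ar A v w j) \<noteq> Some 0)"

text \<open>The tridiagonal matrix; the coefficients have indices starting from 1, the matrix from 0.\<close>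

definition tridiag ::
  "'a \<Rightarrow> nat \<Rightarrow> (nat \<Rightarrow> 'a) \<Rightarrow> (nat \<Rightarrow> 'a) \<Rightarrow> (nat \<Rightarrow> 'a) \<Rightarrow> 'a mat" where
  "tridiag z k \<alpha> \<beta> \<gamma> = mat k k (\<lambda>(i, j).
     if i = j then \<alpha> (i + 1)
     else if j = i + 1 then \<beta> (j + 1)
     else if i = j + 1 then \<gamma> (i + 1)
     else z)"

definition lanczos_T :: "arith \<Rightarrow> real mat \<Rightarrow> real vec \<Rightarrow> real vec \<Rightarrow> nat \<Rightarrow> val mat" where
  "lanczos_T ar A v w k = tridiag (Some 0) k
     (\<lambda>i. coef_alpha (lanczos ar A v w i))
     (\<lambda>i. coef_beta (lanczos ar A v w (i - 1)))
     (\<lambda>i. coef_gamma (lanczos ar A v w (i - 1)))"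

text \<open>The computed quantity (first argument) is the exact one, which is a number.\<close>

definition same_val :: "val \<Rightarrow> val \<Rightarrow> bool" where
  "same_val x y \<longleftrightarrow> x = y \<and> y \<noteq> None"

definition same_vec :: "val vec \<Rightarrow> val vec \<Rightarrow> bool" where
  "same_vec x y \<longleftrightarrow> x = y \<and> (\<forall>k<dim_vec y. y $ k \<noteq> None)"

text \<open>
  Since the values of \<open>\<gamma>\<close> coincide in all executed passes, both runs also stop in the same pass.
  The last four quantities of a pass are assigned only if the algorithm does not stop at \<open>\<gamma>\<close>.
\<close>

definition computes_exactly ::
  "(real \<Rightarrow> val) \<Rightarrow> (val vec \<Rightarrow> sum_tree) \<Rightarrow> real mat \<Rightarrow> real vec \<Rightarrow> real vec \<Rightarrow> bool" where
  "computes_exactly fl ord A v w \<longleftrightarrow>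
     (let F = lanczos (fl, ord) A v w; E = lanczos (Some, ord) A v w in
       same_vec (prev_v (F 0)) (prev_v (E 0)) \<and> same_vec (prev_w (F 0)) (prev_w (E 0)) \<and>
       same_val (coef_gamma (F 0)) (coef_gamma (E 0)) \<and> same_vec (vec_v (F 0)) (vec_v (E 0)) \<and>
       same_val (coef_beta (F 0)) (coef_beta (E 0)) \<and> same_vec (vec_w (F 0)) (vec_w (E 0)) \<and>
       (\<forall>i. executed (Some, ord) A v w i \<longrightarrow>
          same_val (coef_alpha (F i)) (coef_alpha (E i)) \<and>
          same_vec (raw_v (F i)) (raw_v (E i)) \<and>
          same_val (coef_gamma (F i)) (coef_gamma (E i)) \<and>
          (coef_gamma (E i) \<noteq> Some 0 \<longrightarrow>
             same_vec (vec_v (F i)) (vec_v (E i)) \<and>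
             same_vec (raw_w (F i)) (raw_w (E i)) \<and>
             same_val (coef_beta (F i)) (coef_beta (E i)) \<and>
             same_vec (vec_w (F i)) (vec_w (E i)))))"

section \<open>Signed permutation matrices\<close>

definition signed_permutation_mat :: "nat \<Rightarrow> real mat \<Rightarrow> bool" where
  "signed_permutation_mat n P \<longleftrightarrow>
     (\<exists>\<sigma> s. \<sigma> permutes {..<n} \<and> (\<forall>j. s j \<in> {1, -1}) \<and>
        P = mat n n (\<lambda>(i, j). if i = \<sigma> j then s j else 0))"

end

theory Submission
  imports Defs
begin

text \<open>
  In exact arithmetic the Lanczos vectors for this input are the columns of the signed permutation
  matrix \<open>P\<close>, so that \<open>v\<close> and \<open>w\<close> coincide in every pass, and the coefficients are the entries of
  \<open>T\<close>.  Hence every vector that occurs is the product of \<open>P\<close> with a column or row of \<open>T\<close>, with a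
  part of it, or with a multiple of a unit vector.  The signs and the order of the entries do not
  matter to the arithmetic: they are carried along by \<open>embed\<close>, and one may think of \<open>P\<close> as the
  identity.

  Apart from the norms, all operations then have floats as their exact results.  Inner products have
  at most one nonzero term (\<open>dot_embed\<close>, \<open>mat_vec_transform_unit\<close>), differences are of the form
  \<open>x - 0\<close> or \<open>x - x\<close> (\<open>three_term_recurrence\<close>), and quotients are of the form \<open>x / x\<close> or \<open>0 / x\<close> up
  to sign.  Rounding to nearest does not change floats, so these operations are exact in
  any order of summation and with any rule for ties.

  Every nonzero norm is that of some \<open>\<gamma>\<close> times a column of \<open>P\<close>.  The square of \<open>\<gamma>\<close> is rounded, but
  the floating point square root of the rounded square is again \<open>\<gamma>\<close>.  This property of binary
  formats is \<open>sqrt_round_square\<close>; it requires that the square is within the exponent range.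

  The run is described explicitly by \<open>state\<close>, for every rounding function that is exact on the
  numbers in question and recovers each \<open>\<gamma>\<close> from its square in this sense.  Both the
  floating point rounding and the exact arithmetic are such functions, so both runs are the same.
\<close>

section \<open>Squaring and taking the square root in a binary format\<close>

lemma powi_double: "2 * 2 powi k = (2 :: real) powi (k + 1)"
  by (simp add: power_int_add)

lemma powi_split: "(2 :: real) powi k = 2 powi a * 2 powi b" if "k = a + b"
  using that by (simp add: power_int_add)

lemma powi_power_mult: "2 ^ m * (2 :: real) powi a = 2 powi (int m + a)"
  by (simp add: power_int_add)

lemma powi_le_iff: "(2 :: real) powi a \<le> 2 powi b \<longleftrightarrow> a \<le> b"
  and powi_less_iff: "(2 :: real) powi a < 2 powi b \<longleftrightarrow> a < b"
  using power_int_strict_increasing[of a b "2 :: real"] power_int_strict_increasing[of b a "2 :: real"]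
  by (cases a b rule: linorder_cases; simp)+

lemma binade_exists:
  fixes x :: real
  assumes "0 < x"
  obtains k :: int where "2 powi k \<le> x" "x < 2 powi (k + 1)"
proof
  let ?k = "\<lfloor>log 2 x\<rfloor>"
  have "2 powr (of_int ?k) \<le> 2 powr log 2 x" "2 powr log 2 x < 2 powr (of_int (?k + 1))"
    using floor_correct[of "log 2 x"] by auto
  with assms show "2 powi ?k \<le> x" "x < 2 powi (?k + 1)"
    by (auto simp flip: powr_real_of_int')
qed

lemma zero_in_floats: "binary_format p emax \<Longrightarrow> 0 \<in> floats p emax"
  unfolding floats_def binary_format_def
  by (rule CollectI, rule exI[of _ 0], rule exI[of _ 0]) simp

lemma uminus_in_floats:
  assumes "x \<in> floats p emax"
  shows "- x \<in> floats p emax"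
proof -
  obtain m e :: int where "x = of_int m * 2 powi (e - int p + 1)" "\<bar>m\<bar> < 2 ^ p"
      "1 - emax \<le> e" "e \<le> emax"
    using assms unfolding floats_def by blast
  then show ?thesis
    unfolding floats_def by (intro CollectI exI[of _ "- m"] exI[of _ e]) simp
qed

lemma power_of_two_in_floats:
  assumes "binary_format p emax" "1 - emax \<le> k" "k \<le> emax"
  shows "2 powi k \<in> floats p emax"
proof -
  have p: "2 \<le> p" using assms(1) by (simp add: binary_format_def)
  have "2 powi k = of_int (2 ^ (p - 1)) * (2 :: real) powi (k - int p + 1)"
    using p by (simp add: powi_power_mult of_nat_diff)
  moreover have "\<bar>2 ^ (p - 1) :: int\<bar> < 2 ^ p"
    using p by simp
  ultimately show ?thesis
    unfolding floats_def using assms by blast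
qed

lemma one_in_floats: "binary_format p emax \<Longrightarrow> 1 \<in> floats p emax"
  using power_of_two_in_floats[of p emax 0] by (simp add: binary_format_def)

lemma max_float_eq: "max_float p emax = (2 ^ p - 1) * 2 powi (emax - int p + 1)"
proof -
  have "2 powi (emax + 1) = 2 ^ p * (2 :: real) powi (emax - int p + 1)"
    by (simp add: powi_power_mult)
  moreover have "(2 :: real) powi (emax - int p + 1) = 2 powi (1 - int p) * 2 powi emax"
    by (rule powi_split) simp
  ultimately show ?thesis
    by (simp add: max_float_def left_diff_distrib powi_double)
qed

lemma max_float_less: "max_float p emax < 2 powi (emax + 1)"
  by (simp add: max_float_def left_diff_distrib powi_double)

lemma max_float_less_overflow_threshold: "max_float p emax < overflow_threshold p emax"
  by (simp add: max_float_def overflow_threshold_def powi_less_iff)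

lemma floats_le_max_float:
  assumes "x \<in> floats p emax"
  shows "\<bar>x\<bar> \<le> max_float p emax"
proof -
  obtain m e :: int where x: "x = of_int m * 2 powi (e - int p + 1)" "\<bar>m\<bar> < 2 ^ p" "e \<le> emax"
    using assms unfolding floats_def by blast
  have "of_int \<bar>m\<bar> \<le> (of_int (2 ^ p - 1) :: real)"
    using x(2) by (subst of_int_le_iff) linarith
  moreover have "(2 :: real) powi (e - int p + 1) \<le> 2 powi (emax - int p + 1)"
    using x(3) by (simp add: powi_le_iff)
  ultimately have "of_int \<bar>m\<bar> * 2 powi (e - int p + 1) \<le> (2 ^ p - 1) * (2 :: real) powi (emax - int p + 1)"
    by (intro mult_mono) auto
  then show ?thesis
    by (simp add: x(1) abs_mult max_float_eq)
qed

lemma round_exact_on_floats: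
  assumes "round_to_nearest p emax fl" "x \<in> floats p emax"
  shows "fl x = Some x"
proof -
  have "\<bar>x\<bar> < overflow_threshold p emax"
    using floats_le_max_float[OF assms(2)] max_float_less_overflow_threshold by (rule le_less_trans)
  then obtain y where y: "fl x = Some y" "nearest_in (floats p emax) x y"
    using assms(1) unfolding round_to_nearest_def by metis
  then have "\<bar>x - y\<bar> \<le> \<bar>x - x\<bar>"
    using assms(2) unfolding nearest_in_def by blast
  then show ?thesis using y(1) by simp
qed

text \<open>
  A float that is at least \<open>2 powi k\<close> cannot have an exponent below \<open>k\<close>, because the significand
  is less than \<open>2 ^ p\<close>.
\<close>

lemma float_multiple_of_ulp:
  assumes "x \<in> floats p emax" "2 powi k \<le> \<bar>x\<bar>"
  obtains m :: int where "x = of_int m * 2 powi (k - int p + 1)"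
proof -
  obtain m e :: int where x: "x = of_int m * 2 powi (e - int p + 1)" "\<bar>m\<bar> < 2 ^ p"
    using assms unfolding floats_def by blast
  have "\<not> e < k"
  proof
    assume "e < k"
    have "real_of_int \<bar>m\<bar> < real_of_int (2 ^ p)"
      using x(2) by (subst of_int_less_iff)
    then have "\<bar>x\<bar> < 2 ^ p * 2 powi (e - int p + 1)"
      by (simp add: x(1) abs_mult)
    also have "\<dots> = 2 powi (e + 1)"
      by (simp add: powi_power_mult)
    also have "\<dots> \<le> 2 powi k"
      using \<open>e < k\<close> by (simp add: powi_le_iff)
    finally show False using assms(2) by simp
  qed
  then have "(2 :: real) powi (e - int p + 1) = 2 ^ nat (e - k) * 2 powi (k - int p + 1)"
    by (simp add: powi_power_mult algebra_simps)
  then have "x = of_int (m * 2 ^ nat (e - k)) * 2 powi (k - int p + 1)"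
    by (simp add: x(1))
  then show ?thesis by (rule that)
qed

lemma distinct_multiples_apart:
  fixes h :: real
  assumes "0 < h" "of_int a * h \<noteq> of_int b * h"
  shows "h \<le> \<bar>of_int a * h - of_int b * h\<bar>"
proof -
  have "1 \<le> \<bar>a - b\<bar>" using assms(2) by (cases "a = b") auto
  then have "(1 :: real) \<le> of_int \<bar>a - b\<bar>" by simp
  then have "1 * h \<le> of_int \<bar>a - b\<bar> * h"
    using assms(1) by (intro mult_right_mono) auto
  also have "\<dots> = \<bar>of_int a * h - of_int b * h\<bar>"
    using assms(1) by (simp add: abs_mult flip: left_diff_distrib)
  finally show ?thesis by simp
qed

text \<open>
  The half-ulp error bound.  The nearest integer multiple of the ulp is itself a float: its
  significand can reach \<open>2 ^ p\<close>, but then it is the power of two that starts the next binade.  In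
  the topmost binade the significand stays below \<open>2 ^ p\<close>, since \<open>max_float\<close> is the ulp times
  \<open>2 ^ p - 1\<close>.
\<close>

lemma nearest_in_floats_error:
  assumes fmt: "binary_format p emax"
    and near: "nearest_in (floats p emax) x y"
    and range: "within_exponent_range p emax x"
    and l: "x < 2 powi (l + 1)"
  shows "\<bar>x - y\<bar> \<le> 2 powi (l - int p)"
proof -
  have "0 < x"
    using range zero_less_power_int[of "2 :: real" "1 - emax"]
    unfolding within_exponent_range_def min_normal_def by linarith
  then obtain k where k: "2 powi k \<le> x" "x < 2 powi (k + 1)"
    by (rule binade_exists)
  have "(2 :: real) powi (1 - emax) < 2 powi (k + 1)"
    using range k(2) by (auto simp: within_exponent_range_def min_normal_def)
  then have k_ge: "1 - emax \<le> k" by (simp add: powi_less_iff)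
  have "(2 :: real) powi k < 2 powi (emax + 1)"
    using range k(1) max_float_less[of p emax] by (auto simp: within_exponent_range_def)
  then have k_le: "k \<le> emax" by (simp add: powi_less_iff)
  have "(2 :: real) powi k < 2 powi (l + 1)"
    using k(1) l by linarith
  then have "k \<le> l" by (simp add: powi_less_iff)
  define h :: real where "h = 2 powi (k - int p + 1)"
  have h: "0 < h" "2 * 2 powi (k - int p) = h"
    by (auto simp: h_def powi_double)
  define m where "m = round (x / h)"
  have "(of_int m - x / h) * h = of_int m * h - x"
    using h(1) by (simp add: left_diff_distrib)
  then have "\<bar>x - of_int m * h\<bar> = \<bar>(of_int m - x / h) * h\<bar>"
    by (simp only: abs_minus_commute)
  also have "\<dots> = \<bar>of_int m - x / h\<bar> * h"
    using h(1) by (simp only: abs_mult abs_of_pos)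
  also have "\<dots> \<le> 1 / 2 * h"
    unfolding m_def using h(1) of_int_round_abs_le[of "x / h"] by (intro mult_right_mono) auto
  also have "\<dots> = 2 powi (k - int p)"
    using h(2) by simp
  finally have err: "\<bar>x - of_int m * h\<bar> \<le> 2 powi (k - int p)" .
  have m_nonneg: "0 \<le> m"
    unfolding m_def using \<open>0 < x\<close> h(1) round_mono[of 0 "x / h"] by simp
  have "2 ^ p * h = 2 powi (k + 1)"
    by (simp add: h_def powi_power_mult)
  then have "x / h \<le> 2 ^ p"
    using k(2) h(1) by (simp add: divide_le_eq)
  then have m_le: "m \<le> 2 ^ p"
    unfolding m_def using round_mono[of "x / h" "of_int (2 ^ p)"] by (simp only: round_of_int) simp
  have "of_int m * h \<in> floats p emax"
  proof (cases "m = 2 ^ p")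
    case True
    have "k \<noteq> emax"
    proof
      assume "k = emax"
      then have "x / h \<le> of_int (2 ^ p - 1)"
        using range h(1) by (simp add: within_exponent_range_def max_float_eq h_def divide_le_eq)
      then have "m \<le> 2 ^ p - 1"
        unfolding m_def by (metis round_mono round_of_int)
      then show False using True by simp
    qed
    then have "2 powi (k + 1) \<in> floats p emax"
      using k_ge k_le by (intro power_of_two_in_floats[OF fmt]) auto
    then show ?thesis
      using \<open>2 ^ p * h = 2 powi (k + 1)\<close> by (simp add: True)
  next
    case False
    then have "\<bar>m\<bar> < 2 ^ p" using m_nonneg m_le by simp
    then show ?thesis
      unfolding floats_def h_def using k_ge k_le by blast
  qed
  then have "\<bar>x - y\<bar> \<le> \<bar>x - of_int m * h\<bar>"
    using near unfolding nearest_in_def by blast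
  also have "\<dots> \<le> 2 powi (k - int p)" by (rule err)
  also have "\<dots> \<le> 2 powi (l - int p)"
    using \<open>k \<le> l\<close> by (simp add: powi_le_iff)
  finally show ?thesis .
qed

text \<open>
  If \<open>c\<close> is a power of two, then so is its square, and no rounding takes place.  Otherwise let
  \<open>2 powi k < c < 2 powi (k + 1)\<close> and let \<open>h\<close> be the ulp in this binade.  All floats other than
  \<open>c\<close> are at least \<open>h\<close> away from \<open>c\<close>, so it suffices that the square root of the rounded square
  \<open>r\<close> is within less than \<open>h / 2\<close> of \<open>c\<close>.  A deviation of \<open>h / 2\<close> or more would move the square by
  at least \<open>h * (c - h / 4)\<close>, and \<open>c \<ge> 2 powi k + h\<close> makes this larger than \<open>h * 2 powi k\<close>.  But
  the latter bounds the rounding error of the square, which is less than \<open>2 powi (2 * k + 2)\<close>.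
\<close>

lemma sqrt_round_square:
  assumes fmt: "binary_format p emax" and fl: "round_to_nearest p emax fl"
    and c: "c \<in> floats p emax" "0 < c" and range: "within_exponent_range p emax (c\<^sup>2)"
  shows "\<exists>r\<in>floats p emax. 0 \<le> r \<and> fl (c\<^sup>2) = Some r \<and> fl (sqrt r) = Some c"
proof -
  obtain k where k: "2 powi k \<le> c" "c < 2 powi (k + 1)"
    using c(2) by (rule binade_exists)
  show ?thesis
  proof (cases "c = 2 powi k")
    case True
    then have sq: "c\<^sup>2 = 2 powi (2 * k)"
      by (simp add: power_int_mult mult.commute[of 2 k])
    have "(2 :: real) powi (1 - emax) \<le> 2 powi (2 * k)"
      using range unfolding within_exponent_range_def min_normal_def sq by simp
    moreover have "(2 :: real) powi (2 * k) < 2 powi (emax + 1)"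
      using range max_float_less[of p emax] unfolding within_exponent_range_def sq by linarith
    ultimately have "c\<^sup>2 \<in> floats p emax"
      unfolding sq by (intro power_of_two_in_floats[OF fmt]) (auto simp: powi_le_iff powi_less_iff)
    moreover have "sqrt (c\<^sup>2) = c" using c(2) by simp
    ultimately show ?thesis
      using round_exact_on_floats[OF fl] c(1) by (intro bexI[of _ "c\<^sup>2"]) auto
  next
    case False
    define h :: real where "h = 2 powi (k - int p + 1)"
    have h: "0 < h" by (simp add: h_def)
    obtain m where m: "c = of_int m * h"
      unfolding h_def using float_multiple_of_ulp[OF c(1)] k(1) c(2) by auto
    have two_k: "2 powi k = of_int (2 ^ (p - 1)) * h"
      using fmt by (simp add: h_def binary_format_def powi_power_mult of_nat_diff)
    have c_ge: "2 powi k + h \<le> c"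
      using distinct_multiples_apart[OF h, of m "2 ^ (p - 1)"] False k(1) h
      unfolding m[symmetric] two_k[symmetric] by linarith
    \<comment> \<open>Below \<open>2 powi k\<close> the floats are denser, but \<open>c\<close> is not the smallest number of its binade.\<close>
    have gap: "h \<le> \<bar>c - z\<bar>" if z: "z \<in> floats p emax" "z \<noteq> c" for z
    proof (cases "2 powi k \<le> z")
      case True
      then have "2 powi k \<le> \<bar>z\<bar>" by simp
      then obtain j where "z = of_int j * h"
        unfolding h_def by (rule float_multiple_of_ulp[OF z(1)])
      then show ?thesis
        using distinct_multiples_apart[OF h, of m j] z(2) m by simp
    next
      case False
      then show ?thesis using c_ge h by linarith
    qed
    have "\<bar>c\<^sup>2\<bar> < overflow_threshold p emax"
      using range max_float_less_overflow_threshold[of p emax]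
      by (simp add: within_exponent_range_def)
    then obtain r where r: "fl (c\<^sup>2) = Some r" "nearest_in (floats p emax) (c\<^sup>2) r"
      using fl unfolding round_to_nearest_def by metis
    then have r_float: "r \<in> floats p emax"
      unfolding nearest_in_def by blast
    have "\<bar>c\<^sup>2 - r\<bar> \<le> \<bar>c\<^sup>2 - 0\<bar>"
      using r(2) zero_in_floats[OF fmt] unfolding nearest_in_def by blast
    then have r_nonneg: "0 \<le> r" using c(2) by (smt (verit) zero_le_power2)
    have "c\<^sup>2 < (2 powi (k + 1))\<^sup>2"
      using k(2) c(2) by (intro power_strict_mono) auto
    also have "\<dots> = 2 powi (2 * k + 1 + 1)"
      by (simp add: power2_eq_square ac_simps flip: power_int_add)
    finally have "\<bar>c\<^sup>2 - r\<bar> \<le> 2 powi (2 * k + 1 - int p)"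
      by (rule nearest_in_floats_error[OF fmt r(2) range])
    also have "\<dots> = h * 2 powi k"
      unfolding h_def by (rule powi_split) simp
    finally have err: "\<bar>c\<^sup>2 - r\<bar> \<le> h * 2 powi k" .
    have hc: "h * 2 powi k + h * h \<le> h * c"
      using mult_left_mono[OF c_ge, of h] h by (simp add: distrib_left)
    have hh: "0 < h * h" using h by simp
    have close: "\<bar>sqrt r - c\<bar> < h / 2"
    proof (rule ccontr)
      assume "\<not> ?thesis"
      then consider "sqrt r \<le> c - h / 2" | "c + h / 2 \<le> sqrt r" by linarith
      then show False
      proof cases
        case 1
        then have "(sqrt r)\<^sup>2 \<le> (c - h / 2)\<^sup>2"
          using r_nonneg by (intro power_mono) auto
        then have "r \<le> c\<^sup>2 - h * c + h * h / 4"
          using r_nonneg by (simp add: power2_eq_square algebra_simps)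
        then show False using err hc hh by linarith
      next
        case 2
        then have "(c + h / 2)\<^sup>2 \<le> (sqrt r)\<^sup>2"
          using h c(2) by (intro power_mono) auto
        then have "c\<^sup>2 + h * c + h * h / 4 \<le> r"
          using r_nonneg by (simp add: power2_eq_square algebra_simps)
        then show False using err hc hh by linarith
      qed
    qed
    \<comment> \<open>The square root does not overflow.\<close>
    have "sqrt r \<le> max 1 r"
    proof (cases "r \<le> 1")
      case False
      then have "1 * r \<le> r * r" by (intro mult_right_mono) auto
      then show ?thesis
        using False by (intro real_le_lsqrt max.coboundedI2) (auto simp: power2_eq_square)
    qed simp
    also have "\<dots> \<le> max_float p emax"
      using floats_le_max_float[OF r_float] floats_le_max_float[OF one_in_floats[OF fmt]] by simp
    finally have "\<bar>sqrt r\<bar> < overflow_threshold p emax"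
      using max_float_less_overflow_threshold[of p emax] r_nonneg by simp
    then obtain y where y: "fl (sqrt r) = Some y" "nearest_in (floats p emax) (sqrt r) y"
      using fl unfolding round_to_nearest_def by metis
    then have y_near: "y \<in> floats p emax" "\<bar>sqrt r - y\<bar> \<le> \<bar>sqrt r - c\<bar>"
      using c(1) unfolding nearest_in_def by blast+
    have "y = c"
    proof (rule ccontr)
      assume "y \<noteq> c"
      then have "h \<le> \<bar>c - y\<bar>" using gap y_near(1) by blast
      then show False using y_near(2) close by linarith
    qed
    then show ?thesis using r(1) r_float r_nonneg y(1) by blast
  qed
qed

section \<open>Arithmetic without rounding\<close>

text \<open>
  The set \<open>F\<close> contains numbers that the rounding function leaves unchanged.  For floating point
  arithmetic \<open>F\<close> is the set of floats; for exact arithmetic \<open>F\<close> is \<open>UNIV\<close>.  Everything below is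
  derived once, for both.
\<close>

locale exact_arithmetic =
  fixes fl :: "real \<Rightarrow> val" and ord :: "val vec \<Rightarrow> sum_tree" and F :: "real set"
  assumes order: "summation_order ord"
    and exact: "x \<in> F \<Longrightarrow> fl x = Some x"
    and zero: "0 \<in> F" and one: "1 \<in> F" and uminus: "x \<in> F \<Longrightarrow> - x \<in> F"
begin

text \<open>
  A sum with at most one nonzero term is free of rounding in every order of summation, since each
  addition has a zero operand.
\<close>

lemma sum_along_single:
  assumes "distinct (positions t)"
    and "\<And>i. i \<in> set (positions t) \<Longrightarrow> i \<noteq> k \<Longrightarrow> x $ i = Some 0"
    and "k \<in> set (positions t) \<Longrightarrow> x $ k = Some c" and "c \<in> F"
  shows "sum_along fl t x = Some (if k \<in> set (positions t) then c else 0)"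
  using assms
proof (induction t)
  case (Term i)
  then show ?case by (cases "i = k") auto
next
  case (Plus s t)
  have "sum_along fl s x = Some (if k \<in> set (positions s) then c else 0)"
    using Plus.prems by (intro Plus.IH(1)) simp_all
  moreover have "sum_along fl t x = Some (if k \<in> set (positions t) then c else 0)"
    using Plus.prems by (intro Plus.IH(2)) simp_all
  moreover have "\<not> (k \<in> set (positions s) \<and> k \<in> set (positions t))"
    using Plus.prems(1) by auto
  ultimately show ?case
    using Plus.prems(4) by (auto simp: add_op_def lift2_def exact zero)
qed

lemma dot_single:
  assumes "k < dim_vec y"
    and "\<And>i. i < dim_vec y \<Longrightarrow> i \<noteq> k \<Longrightarrow> mul_op fl (x $ i) (y $ i) = Some 0"
    and "mul_op fl (x $ k) (y $ k) = Some c" and "c \<in> F"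
  shows "dot (fl, ord) x y = Some c"
proof -
  define z where "z = vec (dim_vec y) (\<lambda>i. mul_op fl (x $ i) (y $ i))"
  have "0 < dim_vec z" using assms(1) by (simp add: z_def)
  then have "distinct (positions (ord z))" "set (positions (ord z)) = {..<dim_vec y}"
    using order unfolding summation_order_def by (auto simp: z_def)
  then have "sum_along fl (ord z) z = Some c"
    using sum_along_single[of "ord z" k z c] assms by (simp add: z_def)
  then show ?thesis by (simp add: z_def Let_def)
qed

end

section \<open>Vectors and matrices transformed by a signed permutation\<close>

definition unit_fun :: "nat \<Rightarrow> nat \<Rightarrow> real" where
  "unit_fun j i = (if i = j then 1 else 0)"

text \<open>
  The signed permutation matrix is the one that has the entry \<open>s k\<close> in position \<open>(k, \<tau> k)\<close>, for
  each row \<open>k\<close>.  Thus \<open>embed x\<close> is the product of this matrix with the vector \<open>x\<close>, and \<open>transform t\<close>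
  is the matrix \<open>t\<close> transformed to the new basis.
\<close>

locale signed_permuted_arithmetic = exact_arithmetic +
  fixes n :: nat and \<tau> :: "nat \<Rightarrow> nat" and s :: "nat \<Rightarrow> real"
  assumes perm: "\<tau> permutes {..<n}" and sign: "s k = 1 \<or> s k = - 1"
begin

definition embed :: "(nat \<Rightarrow> real) \<Rightarrow> val vec" where
  "embed x = vec n (\<lambda>k. Some (s k * x (\<tau> k)))"

definition transform :: "(nat \<Rightarrow> nat \<Rightarrow> real) \<Rightarrow> val mat" where
  "transform t = mat n n (\<lambda>(k, l). Some (s k * s l * t (\<tau> k) (\<tau> l)))"

lemma dim_embed [simp]: "dim_vec (embed x) = n"
  by (simp add: embed_def)

lemma dim_transform [simp]: "dim_row (transform t) = n"
  by (simp add: transform_def)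

lemma transpose_transform: "transpose_mat (transform t) = transform (\<lambda>i j. t j i)"
  by (auto simp: transform_def)

lemma sign_square [simp]: "s k * s k = 1" "s k * (s k * a) = a" "s k \<noteq> 0"
  using sign[of k] by auto

lemma sign_mult_closed: "x \<in> F \<Longrightarrow> s k * x \<in> F"
  using sign[of k] uminus by auto

lemma perm_less [simp]: "\<tau> k < n \<longleftrightarrow> k < n"
  using permutes_in_image[OF perm, of k] by simp

lemma perm_preimage:
  assumes "j < n"
  obtains k where "k < n" "\<tau> k = j" "\<And>i. \<tau> i = j \<Longrightarrow> i = k"
proof
  have "\<tau> (inv_into UNIV \<tau> j) = j"
    by (rule permutes_inverses(1)[OF perm])
  then show "\<tau> (inv_into UNIV \<tau> j) = j" "inv_into UNIV \<tau> j < n"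
    using assms perm_less[of "inv_into UNIV \<tau> j"] by simp_all
  show "i = inv_into UNIV \<tau> j" if "\<tau> i = j" for i
    using that permutes_inverses(2)[OF perm, of i] by simp
qed

lemma embed_cong: "(\<And>i. i < n \<Longrightarrow> x i = y i) \<Longrightarrow> embed x = embed y"
  by (auto simp: embed_def)

text \<open>The signs cancel in the products.\<close>

lemma dot_embed:
  assumes "j < n" and "\<And>i. i < n \<Longrightarrow> i \<noteq> j \<Longrightarrow> x i * y i = 0"
    and "fl (x j * y j) = Some c" and "c \<in> F"
  shows "dot (fl, ord) (embed x) (embed y) = Some c"
proof -
  obtain k where k: "k < n" "\<tau> k = j" "\<And>i. \<tau> i = j \<Longrightarrow> i = k"
    using perm_preimage[OF assms(1)] by blast
  have mul: "mul_op fl (embed x $ i) (embed y $ i) = fl (x (\<tau> i) * y (\<tau> i))" if "i < n" for i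
  proof -
    have "s i * x (\<tau> i) * (s i * y (\<tau> i)) = (s i * s i) * (x (\<tau> i) * y (\<tau> i))"
      by (simp only: mult_ac)
    also have "\<dots> = x (\<tau> i) * y (\<tau> i)" by simp
    finally have "fl (s i * x (\<tau> i) * (s i * y (\<tau> i))) = fl (x (\<tau> i) * y (\<tau> i))"
      by (simp only:)
    then show ?thesis using that by (simp add: embed_def mul_op_def lift2_def)
  qed
  show ?thesis
  proof (rule dot_single[of k])
    fix i assume i: "i < dim_vec (embed y)" "i \<noteq> k"
    then have "\<tau> i \<noteq> j" using k(3) by blast
    then have "x (\<tau> i) * y (\<tau> i) = 0"
      using i(1) by (intro assms(2)) auto
    then show "mul_op fl (embed x $ i) (embed y $ i) = Some 0"
      using mul[of i] i(1) by (simp only: exact[OF zero] dim_embed)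
  qed (use k(1,2) mul assms(3,4) in auto)
qed

lemma mat_vec_transform_unit:
  assumes "j < n" and "\<And>i. i < n \<Longrightarrow> t i j \<in> F"
  shows "mat_vec (fl, ord) (transform t) (embed (unit_fun j)) = embed (\<lambda>i. t i j)"
proof -
  obtain l where l: "l < n" "\<tau> l = j" "\<And>i. \<tau> i = j \<Longrightarrow> i = l"
    using perm_preimage[OF assms(1)] by blast
  have "dot (fl, ord) (row (transform t) k) (embed (unit_fun j)) = Some (s k * t (\<tau> k) j)"
    if k: "k < n" for k
  proof (rule dot_single[of l])
    show closed: "s k * t (\<tau> k) j \<in> F"
      using k assms(2) by (intro sign_mult_closed) auto
    have "s k * s l * t (\<tau> k) j * s l = (s l * s l) * (s k * t (\<tau> k) j)"
      by (simp only: mult_ac)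
    also have "\<dots> = s k * t (\<tau> k) j" by simp
    finally have "fl (s k * s l * t (\<tau> k) j * s l) = Some (s k * t (\<tau> k) j)"
      by (simp only: exact[OF closed])
    then show "mul_op fl (row (transform t) k $ l) (embed (unit_fun j) $ l) = Some (s k * t (\<tau> k) j)"
      using k l(1,2) by (simp add: transform_def embed_def unit_fun_def mul_op_def lift2_def)
    fix i assume i: "i < dim_vec (embed (unit_fun j))" "i \<noteq> l"
    then have "\<tau> i \<noteq> j" using l(3) by blast
    then show "mul_op fl (row (transform t) k $ i) (embed (unit_fun j) $ i) = Some 0"
      using k i(1) by (auto simp: transform_def embed_def unit_fun_def mul_op_def lift2_def exact zero)
  qed (use l(1) in simp)
  then have "mat_vec (fl, ord) (transform t) (embed (unit_fun j)) $ k = Some (s k * t (\<tau> k) j)"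
    if "k < n" for k
    using that by (simp add: mat_vec_def del: dot.simps)
  then show ?thesis
    by (intro eq_vecI) (simp_all add: mat_vec_def embed_def)
qed

lemma scale_embed:
  assumes "\<And>i. i < n \<Longrightarrow> c * x i \<in> F"
  shows "scale (fl, ord) (Some c) (embed x) = embed (\<lambda>i. c * x i)"
proof -
  have "fl (c * (s k * x (\<tau> k))) = Some (s k * (c * x (\<tau> k)))" if "k < n" for k
    using exact[OF sign_mult_closed[OF assms[of "\<tau> k"], of k]] that
    by (simp add: mult.left_commute)
  then show ?thesis
    by (auto simp: embed_def mul_op_def lift2_def)
qed

lemma divide_embed:
  assumes "c \<noteq> 0" and "\<And>i. i < n \<Longrightarrow> x i / c \<in> F"
  shows "divide_by (fl, ord) (embed x) (Some c) = embed (\<lambda>i. x i / c)"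
proof -
  have "fl (s k * x (\<tau> k) / c) = Some (s k * (x (\<tau> k) / c))" if "k < n" for k
    using exact[OF sign_mult_closed[OF assms(2)[of "\<tau> k"], of k]] that by simp
  then show ?thesis
    using assms(1) by (auto simp: embed_def div_op_def lift2_def)
qed

lemma sub_embed:
  assumes "\<And>i. i < n \<Longrightarrow> x i - y i \<in> F"
  shows "sub_vec (fl, ord) (embed x) (embed y) = embed (\<lambda>i. x i - y i)"
proof -
  have "fl (s k * x (\<tau> k) - s k * y (\<tau> k)) = Some (s k * x (\<tau> k) - s k * y (\<tau> k))" if "k < n" for k
    using exact[OF sign_mult_closed[OF assms[of "\<tau> k"], of k]] that
    by (simp add: right_diff_distrib)
  then show ?thesis
    by (auto simp: embed_def sub_op_def lift2_def right_diff_distrib)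
qed

lemma divide_multiple_of_unit:
  assumes "c \<noteq> 0"
  shows "divide_by (fl, ord) (embed (\<lambda>i. c * unit_fun j i)) (Some c) = embed (unit_fun j)"
proof -
  have "divide_by (fl, ord) (embed (\<lambda>i. c * unit_fun j i)) (Some c) =
      embed (\<lambda>i. c * unit_fun j i / c)"
    using assms zero one by (intro divide_embed) (auto simp: unit_fun_def)
  also have "(\<lambda>i. c * unit_fun j i / c) = unit_fun j"
    using assms by (intro ext) simp
  finally show ?thesis .
qed

lemma norm2_multiple_of_unit:
  assumes "j < n" and "r \<in> F" "0 \<le> r" "fl (c\<^sup>2) = Some r" "fl (sqrt r) = Some c"
  shows "norm2 (fl, ord) (embed (\<lambda>i. c * unit_fun j i)) = Some c"
proof -
  have "dot (fl, ord) (embed (\<lambda>i. c * unit_fun j i)) (embed (\<lambda>i. c * unit_fun j i)) = Some r"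
    using assms by (intro dot_embed[of j]) (auto simp: unit_fun_def power2_eq_square)
  then show ?thesis
    using assms by (simp add: sqrt_op_def del: dot.simps)
qed

lemma norm2_zero:
  assumes "0 < n"
  shows "norm2 (fl, ord) (embed (\<lambda>_. 0)) = Some 0"
  using norm2_multiple_of_unit[OF assms zero, of 0]
  by (simp add: exact[OF zero] del: norm2.simps)

end

section \<open>The run of the Lanczos algorithm\<close>

definition tridiag_fun ::
  "(nat \<Rightarrow> real) \<Rightarrow> (nat \<Rightarrow> real) \<Rightarrow> (nat \<Rightarrow> real) \<Rightarrow> nat \<Rightarrow> nat \<Rightarrow> real" where
  "tridiag_fun \<alpha> \<beta> \<gamma> i j =
     (if i = j then \<alpha> (i + 1)
      else if j = i + 1 then \<beta> (j + 1)
      else if i = j + 1 then \<gamma> (i + 1)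
      else 0)"

locale tridiagonal_lanczos = signed_permuted_arithmetic +
  fixes \<alpha> \<beta> \<gamma> :: "nat \<Rightarrow> real"
  assumes pos: "0 < n"
    and entries: "i < n \<Longrightarrow> j < n \<Longrightarrow> tridiag_fun \<alpha> \<beta> \<gamma> i j \<in> F"
    and beta: "i < n \<Longrightarrow> \<beta> (Suc i) \<in> F" "i < n \<Longrightarrow> \<beta> (Suc i) \<noteq> 0"
    and gamma: "i < n \<Longrightarrow> \<gamma> (Suc i) \<in> F" "i < n \<Longrightarrow> 0 < \<gamma> (Suc i)"
    and sqrt_square: "i < n \<Longrightarrow>
      \<exists>r\<in>F. 0 \<le> r \<and> fl ((\<gamma> (Suc i))\<^sup>2) = Some r \<and> fl (sqrt r) = Some (\<gamma> (Suc i))"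
begin

abbreviation "ar \<equiv> (fl, ord)"

text \<open>
  The vectors of pass \<open>i\<close> are multiples of the transformed unit vector with index \<open>i\<close>, where the
  unit vectors are counted from 0.  For \<open>i = 0\<close> no index \<open>k\<close> satisfies \<open>Suc k = i\<close>, and the
  previous vectors are zero, as the algorithm wants it.
\<close>

definition state :: "nat \<Rightarrow> lanczos_state" where
  "state i =
     \<lparr>coef_alpha = (if i = 0 then None else Some (\<alpha> i)),
      raw_v = embed (\<lambda>k. \<gamma> (Suc i) * unit_fun i k), coef_gamma = Some (\<gamma> (Suc i)),
      vec_v = embed (unit_fun i),
      raw_w = embed (\<lambda>k. \<beta> (Suc i) * unit_fun i k), coef_beta = Some (\<beta> (Suc i)),
      vec_w = embed (unit_fun i),
      prev_v = embed (\<lambda>k. if Suc k = i then 1 else 0),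
      prev_w = embed (\<lambda>k. if Suc k = i then 1 else 0)\<rparr>"

lemma norm2_gamma:
  assumes "i < n"
  shows "norm2 ar (embed (\<lambda>k. \<gamma> (Suc i) * unit_fun i k)) = Some (\<gamma> (Suc i))"
  using sqrt_square[OF assms] norm2_multiple_of_unit[OF assms] by blast

lemma dot_unit_beta:
  assumes "i < n"
  shows "dot ar (embed (unit_fun i)) (embed (\<lambda>k. \<beta> (Suc i) * unit_fun i k)) = Some (\<beta> (Suc i))"
    and "dot ar (embed (\<lambda>k. \<beta> (Suc i) * unit_fun i k)) (embed (unit_fun i)) = Some (\<beta> (Suc i))"
  using assms beta(1)[OF assms]
  by (intro dot_embed[of i]; simp add: unit_fun_def exact)+

lemma lanczos_init_state:
  "lanczos_init ar (embed (\<lambda>k. \<gamma> 1 * unit_fun 0 k)) (embed (\<lambda>k. \<beta> 1 * unit_fun 0 k)) = state 0"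
proof -
  have "vec n (\<lambda>_. Some 0) = embed (\<lambda>_. 0)"
    by (simp add: embed_def)
  then show ?thesis
    using norm2_gamma[OF pos] dot_unit_beta[OF pos] gamma(2)[OF pos] beta(2)[OF pos]
    by (simp add: lanczos_init_def state_def Let_def divide_multiple_of_unit
        del: dot.simps norm2.simps divide_by.simps)
qed

text \<open>
  With \<open>i\<close> counted from 0, column \<open>i\<close> of the tridiagonal matrix contains \<open>\<beta> (Suc i)\<close>,
  \<open>\<alpha> (Suc i)\<close> and \<open>\<gamma> (Suc (Suc i))\<close>.  The two subtractions of a pass remove the first two of
  them one after the other, by taking equal numbers from each other, and leave the other entries
  as they are.  In row \<open>i\<close> the roles of \<open>\<beta>\<close> and \<open>\<gamma>\<close> are exchanged.
\<close>

lemma three_term_recurrence: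
  assumes i: "i < n"
    and t: "\<And>k. k < n \<Longrightarrow> t k \<in> F"
    and diag: "t i = a" and upper: "\<And>k. Suc k = i \<Longrightarrow> t k = b" and b: "b \<in> F"
    and far: "\<And>k. k < n \<Longrightarrow> k \<noteq> i \<Longrightarrow> Suc k \<noteq> i \<Longrightarrow> k \<noteq> Suc i \<Longrightarrow> t k = 0"
  shows "sub_vec ar (sub_vec ar (embed t) (scale ar (Some a) (embed (unit_fun i))))
      (scale ar (Some b) (embed (\<lambda>k. if Suc k = i then 1 else 0)))
    = embed (\<lambda>k. t (Suc i) * unit_fun (Suc i) k)"
proof -
  have a: "a \<in> F" using t[OF i] diag by simp
  have 1: "scale ar (Some a) (embed (unit_fun i)) = embed (\<lambda>k. a * unit_fun i k)"
    using a zero by (intro scale_embed) (simp add: unit_fun_def)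
  have 2: "scale ar (Some b) (embed (\<lambda>k. if Suc k = i then 1 else 0)) =
      embed (\<lambda>k. b * (if Suc k = i then 1 else 0))"
    using b zero by (intro scale_embed) simp
  have 3: "sub_vec ar (embed t) (embed (\<lambda>k. a * unit_fun i k)) =
      embed (\<lambda>k. t k - a * unit_fun i k)"
    using t zero diag by (intro sub_embed) (simp add: unit_fun_def)
  have rest: "t k - a * unit_fun i k - b * (if Suc k = i then 1 else 0) =
      t (Suc i) * unit_fun (Suc i) k" if "k < n" for k
    using that diag upper[of k] far[of k] by (auto simp: unit_fun_def)
  have "sub_vec ar (embed (\<lambda>k. t k - a * unit_fun i k))
      (embed (\<lambda>k. b * (if Suc k = i then 1 else 0))) =
      embed (\<lambda>k. t k - a * unit_fun i k - b * (if Suc k = i then 1 else 0))"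
    using t zero by (intro sub_embed, subst rest) (auto simp: unit_fun_def)
  also have "\<dots> = embed (\<lambda>k. t (Suc i) * unit_fun (Suc i) k)"
    using rest by (rule embed_cong)
  finally show ?thesis by (simp only: 1 2 3)
qed

abbreviation "M \<equiv> transform (tridiag_fun \<alpha> \<beta> \<gamma>)"

lemma pass_alpha_and_raw_vectors:
  assumes i: "i < n"
  shows "coef_alpha (lanczos_pass ar M (state i)) = Some (\<alpha> (Suc i))"
    and "raw_v (lanczos_pass ar M (state i)) =
      embed (\<lambda>k. \<gamma> (Suc (Suc i)) * unit_fun (Suc i) k)"
    and "raw_w (lanczos_pass ar M (state i)) =
      embed (\<lambda>k. \<beta> (Suc (Suc i)) * unit_fun (Suc i) k)"
proof -
  let ?t = "tridiag_fun \<alpha> \<beta> \<gamma>"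
  have Av: "mat_vec ar M (embed (unit_fun i)) = embed (\<lambda>k. ?t k i)"
    using i entries by (intro mat_vec_transform_unit) auto
  have Aw: "mat_vec ar (transpose_mat M) (embed (unit_fun i)) = embed (\<lambda>k. ?t i k)"
    unfolding transpose_transform using i entries by (intro mat_vec_transform_unit) auto
  have "?t i i \<in> F" using i entries by blast
  then have alpha: "dot ar (embed (unit_fun i)) (embed (\<lambda>k. ?t k i)) = Some (\<alpha> (Suc i))"
    using i by (intro dot_embed[of i]) (auto simp: unit_fun_def tridiag_fun_def exact)
  have v: "sub_vec ar
        (sub_vec ar (embed (\<lambda>k. ?t k i)) (scale ar (Some (\<alpha> (Suc i))) (embed (unit_fun i))))
        (scale ar (Some (\<beta> (Suc i))) (embed (\<lambda>k. if Suc k = i then 1 else 0))) =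
      embed (\<lambda>k. ?t (Suc i) i * unit_fun (Suc i) k)"
    using i entries beta by (intro three_term_recurrence) (auto simp: tridiag_fun_def)
  have w: "sub_vec ar
        (sub_vec ar (embed (\<lambda>k. ?t i k)) (scale ar (Some (\<alpha> (Suc i))) (embed (unit_fun i))))
        (scale ar (Some (\<gamma> (Suc i))) (embed (\<lambda>k. if Suc k = i then 1 else 0))) =
      embed (\<lambda>k. ?t i (Suc i) * unit_fun (Suc i) k)"
    using i entries gamma by (intro three_term_recurrence) (auto simp: tridiag_fun_def)
  have sub: "?t (Suc i) i = \<gamma> (Suc (Suc i))" and sup: "?t i (Suc i) = \<beta> (Suc (Suc i))"
    by (auto simp: tridiag_fun_def)
  show "coef_alpha (lanczos_pass ar M (state i)) = Some (\<alpha> (Suc i))"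
    by (simp add: lanczos_pass_def state_def Let_def Av alpha del: dot.simps)
  show "raw_v (lanczos_pass ar M (state i)) =
      embed (\<lambda>k. \<gamma> (Suc (Suc i)) * unit_fun (Suc i) k)"
    by (simp add: lanczos_pass_def state_def Let_def Av alpha v[unfolded sub]
        del: dot.simps sub_vec.simps scale.simps)
  show "raw_w (lanczos_pass ar M (state i)) =
      embed (\<lambda>k. \<beta> (Suc (Suc i)) * unit_fun (Suc i) k)"
    by (simp add: lanczos_pass_def state_def Let_def Av Aw alpha w[unfolded sup]
        del: dot.simps sub_vec.simps scale.simps)
qed

text \<open>
  The rest of a pass is the normalization of the two vectors \<open>raw_v\<close> and \<open>raw_w\<close>.  It is
  separated from their computation, which also covers the last pass.
\<close>

lemma pass_fields:
  fixes st :: lanczos_state and A :: "val mat"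
  defines "st' \<equiv> lanczos_pass ar A st"
  shows "st' = \<lparr>coef_alpha = coef_alpha st', raw_v = raw_v st', coef_gamma = norm2 ar (raw_v st'),
    vec_v = divide_by ar (raw_v st') (norm2 ar (raw_v st')), raw_w = raw_w st',
    coef_beta = dot ar (divide_by ar (raw_v st') (norm2 ar (raw_v st'))) (raw_w st'),
    vec_w = divide_by ar (raw_w st')
      (dot ar (divide_by ar (raw_v st') (norm2 ar (raw_v st'))) (raw_w st')),
    prev_v = vec_v st, prev_w = vec_w st\<rparr>"
  unfolding st'_def
  by (simp add: lanczos_pass_def Let_def
      del: dot.simps norm2.simps divide_by.simps sub_vec.simps scale.simps)

lemma lanczos_pass_state:
  assumes "Suc i < n"
  shows "lanczos_pass ar M (state i) = state (Suc i)"
proof -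
  have i: "i < n" using assms by simp
  note pass = pass_alpha_and_raw_vectors[OF i]
  have prev: "unit_fun i = (\<lambda>k. if k = i then 1 else 0)"
    by (auto simp: unit_fun_def)
  have v: "divide_by ar (embed (\<lambda>k. \<gamma> (Suc (Suc i)) * unit_fun (Suc i) k))
      (Some (\<gamma> (Suc (Suc i)))) = embed (unit_fun (Suc i))"
    using gamma(2)[OF assms] by (intro divide_multiple_of_unit) simp
  have w: "divide_by ar (embed (\<lambda>k. \<beta> (Suc (Suc i)) * unit_fun (Suc i) k))
      (Some (\<beta> (Suc (Suc i)))) = embed (unit_fun (Suc i))"
    using beta(2)[OF assms] by (intro divide_multiple_of_unit) simp
  have "vec_v (state i) = embed (\<lambda>k. if Suc k = Suc i then 1 else 0)"
    and "vec_w (state i) = embed (\<lambda>k. if Suc k = Suc i then 1 else 0)"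
    by (simp_all add: state_def prev)
  then show ?thesis
    by (subst pass_fields, unfold pass norm2_gamma[OF assms] v dot_unit_beta(1)[OF assms] w)
      (simp add: state_def)
qed

text \<open>
  Pass \<open>n\<close> would produce a multiple of the unit vector with index \<open>n\<close>.  There is no such vector, so
  the result is zero and the algorithm stops.
\<close>

lemma last_pass:
  assumes "Suc i = n"
  shows "raw_v (lanczos_pass ar M (state i)) = embed (\<lambda>_. 0)"
    and "coef_gamma (lanczos_pass ar M (state i)) = Some 0"
proof -
  have "embed (\<lambda>k. \<gamma> (Suc (Suc i)) * unit_fun (Suc i) k) = embed (\<lambda>_. 0)"
    using assms by (intro embed_cong) (simp add: unit_fun_def)
  then show raw: "raw_v (lanczos_pass ar M (state i)) = embed (\<lambda>_. 0)"
    using pass_alpha_and_raw_vectors(2)[of i] assms by simp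
  show "coef_gamma (lanczos_pass ar M (state i)) = Some 0"
    by (subst pass_fields) (simp add: raw norm2_zero[OF pos] del: norm2.simps)
qed

context
  fixes A :: "real mat" and v w :: "real vec"
  assumes A: "map_mat Some A = M"
    and v: "map_vec Some v = embed (\<lambda>k. \<gamma> 1 * unit_fun 0 k)"
    and w: "map_vec Some w = embed (\<lambda>k. \<beta> 1 * unit_fun 0 k)"
begin

lemma lanczos_eq_state: "i < n \<Longrightarrow> lanczos ar A v w i = state i"
  by (induction i) (simp_all only: lanczos.simps A v w lanczos_init_state lanczos_pass_state Suc_lessD)

lemma lanczos_last:
  shows "coef_alpha (lanczos ar A v w n) = Some (\<alpha> n)"
    and "raw_v (lanczos ar A v w n) = embed (\<lambda>_. 0)"
    and "coef_gamma (lanczos ar A v w n) = Some 0"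
proof -
  obtain i where i: "n = Suc i" using pos by (cases n) auto
  then have eq: "lanczos ar A v w n = lanczos_pass ar M (state i)"
    by (simp add: A lanczos_eq_state)
  show "coef_alpha (lanczos ar A v w n) = Some (\<alpha> n)"
    "raw_v (lanczos ar A v w n) = embed (\<lambda>_. 0)"
    "coef_gamma (lanczos ar A v w n) = Some 0"
    unfolding eq using pass_alpha_and_raw_vectors(1)[of i] last_pass[of i] i by auto
qed

lemma lanczos_T_eq: "lanczos_T ar A v w n = map_mat Some (tridiag 0 n \<alpha> \<beta> \<gamma>)"
proof (rule eq_matI)
  have alpha: "coef_alpha (lanczos ar A v w (Suc i)) = Some (\<alpha> (Suc i))" if "i < n" for i
    using that lanczos_eq_state[of "Suc i"] lanczos_last(1)
    by (cases "Suc i = n") (auto simp: state_def simp del: lanczos.simps)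
  fix i j assume "i < dim_row (map_mat Some (tridiag 0 n \<alpha> \<beta> \<gamma>))"
    "j < dim_col (map_mat Some (tridiag 0 n \<alpha> \<beta> \<gamma>))"
  then have ij: "i < n" "j < n" by (auto simp: tridiag_def)
  show "lanczos_T ar A v w n $$ (i, j) = map_mat Some (tridiag 0 n \<alpha> \<beta> \<gamma>) $$ (i, j)"
    using ij alpha by (simp add: lanczos_T_def tridiag_def lanczos_eq_state state_def
        del: lanczos.simps)
qed (auto simp: lanczos_T_def tridiag_def)

end

end

text \<open>
  The two runs are described by the same explicit states, whose entries are all numbers.  In the
  last pass only the quantities up to the vanishing \<open>\<gamma>\<close> are compared.
\<close>

lemma computes_exactly_if_same_data:
  assumes "tridiagonal_lanczos fl ord F n \<tau> s \<alpha> \<beta> \<gamma>"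
    and "tridiagonal_lanczos Some ord G n \<tau> s \<alpha> \<beta> \<gamma>"
    and A: "map_mat Some A = signed_permuted_arithmetic.transform n \<tau> s (tridiag_fun \<alpha> \<beta> \<gamma>)"
    and v: "map_vec Some v = signed_permuted_arithmetic.embed n \<tau> s (\<lambda>k. \<gamma> 1 * unit_fun 0 k)"
    and w: "map_vec Some w = signed_permuted_arithmetic.embed n \<tau> s (\<lambda>k. \<beta> 1 * unit_fun 0 k)"
  shows "computes_exactly fl ord A v w"
proof -
  interpret fp: tridiagonal_lanczos fl ord F n \<tau> s \<alpha> \<beta> \<gamma> by fact
  interpret ex: tridiagonal_lanczos Some ord G n \<tau> s \<alpha> \<beta> \<gamma> by fact
  note fp_run = fp.lanczos_eq_state[OF A v w] fp.lanczos_last[OF A v w]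
  note ex_run = ex.lanczos_eq_state[OF A v w] ex.lanczos_last[OF A v w]
  have vec [simp]: "same_vec (fp.embed x) (fp.embed x)" for x
    by (simp add: same_vec_def fp.embed_def)
  have val [simp]: "same_val (Some x) (Some x)" for x
    by (simp add: same_val_def)
  have dim: "dim_row A = n"
    using arg_cong[OF A, of dim_row] by (simp add: fp.transform_def)
  let ?F = "lanczos (fl, ord) A v w" and ?E = "lanczos (Some, ord) A v w"
  have "same_val (coef_alpha (?F i)) (coef_alpha (?E i)) \<and>
      same_vec (raw_v (?F i)) (raw_v (?E i)) \<and>
      same_val (coef_gamma (?F i)) (coef_gamma (?E i)) \<and>
      (coef_gamma (?E i) \<noteq> Some 0 \<longrightarrow>
         same_vec (vec_v (?F i)) (vec_v (?E i)) \<and>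
         same_vec (raw_w (?F i)) (raw_w (?E i)) \<and>
         same_val (coef_beta (?F i)) (coef_beta (?E i)) \<and>
         same_vec (vec_w (?F i)) (vec_w (?E i)))"
    if "executed (Some, ord) A v w i" for i
  proof -
    have i: "1 \<le> i" "i \<le> n"
      using that by (auto simp: executed_def dim)
    show ?thesis
    proof (cases "i = n")
      case True
      then show ?thesis by (simp only: fp_run(2-) ex_run(2-)) simp
    next
      case False
      then show ?thesis
        using i by (simp add: fp_run(1) ex_run(1) fp.state_def ex.state_def)
    qed
  qed
  then show ?thesis
    unfolding computes_exactly_def Let_def
    by (simp add: fp_run(1)[OF fp.pos] ex_run(1)[OF fp.pos] fp.state_def ex.state_def
        del: lanczos.simps)
qed

section \<open>Floating point and exact arithmetic on the same data\<close>

lemma signed_permutation_mat_rows: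
  assumes "signed_permutation_mat n P"
  obtains \<tau> s where "\<tau> permutes {..<n}" "\<And>k. s k = 1 \<or> s k = - 1"
    "P = mat n n (\<lambda>(k, j). if j = \<tau> k then s k else 0)"
proof -
  obtain \<sigma> s where \<sigma>: "\<sigma> permutes {..<n}" and s: "\<And>j. s j \<in> {1, - 1 :: real}"
    and P: "P = mat n n (\<lambda>(i, j). if i = \<sigma> j then s j else 0)"
    using assms unfolding signed_permutation_mat_def by blast
  show ?thesis
  proof
    show "inv_into UNIV \<sigma> permutes {..<n}" by (rule permutes_inv[OF \<sigma>])
    show "s (inv_into UNIV \<sigma> k) = 1 \<or> s (inv_into UNIV \<sigma> k) = - 1" for k using s[of "inv_into UNIV \<sigma> k"] by simp
    have "i = \<sigma> j \<longleftrightarrow> j = inv_into UNIV \<sigma> i" for i j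
      using permutes_inv_eq[OF \<sigma>, of i j] by auto
    then show "P = mat n n (\<lambda>(k, j). if j = inv_into UNIV \<sigma> k then s (inv_into UNIV \<sigma> k) else 0)"
      unfolding P by (intro eq_matI) auto
  qed
qed

lemma signed_permutation_mat_mult_vec:
  assumes "\<tau> permutes {..<n}" "k < n" "dim_vec x = n"
  shows "(mat n n (\<lambda>(k, j). if j = \<tau> k then s k else 0) *\<^sub>v x) $ k = s k * (x $ \<tau> k :: real)"
proof -
  have "\<tau> k < n" using permutes_in_image[OF assms(1), of k] assms(2) by simp
  then show ?thesis
    using assms by (simp add: scalar_prod_def if_distrib[where f = "\<lambda>a. a * _"] sum.delta cong: if_cong)
qed

lemma signed_permutation_mat_conjugate:
  fixes T :: "real mat"
  assumes \<tau>: "\<tau> permutes {..<n}" and T: "T \<in> carrier_mat n n"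
    and P: "P = mat n n (\<lambda>(k, j). if j = \<tau> k then s k else 0)"
  shows "P * T * transpose_mat P = mat n n (\<lambda>(k, l). s k * s l * T $$ (\<tau> k, \<tau> l))"
proof (rule eq_matI)
  fix k l assume "k < dim_row (mat n n (\<lambda>(k, l). s k * s l * T $$ (\<tau> k, \<tau> l)))"
    "l < dim_col (mat n n (\<lambda>(k, l). s k * s l * T $$ (\<tau> k, \<tau> l)))"
  then have kl: "k < n" "l < n" by auto
  then have \<tau>kl: "\<tau> k < n" "\<tau> l < n"
    using permutes_in_image[OF \<tau>] by auto
  have PT: "(P * T) $$ (k, j) = s k * T $$ (\<tau> k, j)" if "j < n" for j
    using kl that T \<tau>kl
    by (simp add: P scalar_prod_def if_distrib[where f = "\<lambda>a. a * _"] sum.delta cong: if_cong)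
  have P_row: "P $$ (l, j) = (if j = \<tau> l then s l else 0)" if "j < n" for j
    using kl that by (simp add: P)
  have "(P * T * transpose_mat P) $$ (k, l) = (\<Sum>j = 0..<n. (P * T) $$ (k, j) * P $$ (l, j))"
    using kl T by (simp add: P scalar_prod_def)
  also have "\<dots> = (\<Sum>j = 0..<n. if j = \<tau> l then s k * T $$ (\<tau> k, j) * s l else 0)"
    by (intro sum.cong) (auto simp: PT P_row)
  finally show "(P * T * transpose_mat P) $$ (k, l) =
      mat n n (\<lambda>(k, l). s k * s l * T $$ (\<tau> k, \<tau> l)) $$ (k, l)"
    using kl \<tau>kl by simp
qed (auto simp: P)

theorem theorem6p2:
  fixes p n :: nat and emax :: int
    and fl :: "real \<Rightarrow> real option" and ord :: "real option vec \<Rightarrow> sum_tree"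
    and P T A :: "real mat" and v w :: "real vec"
    and \<alpha> \<beta> \<gamma> :: "nat \<Rightarrow> real"
  assumes "binary_format p emax"
    and "round_to_nearest p emax fl"
    and "summation_order ord"
    and "n \<ge> 1"
    and "signed_permutation_mat n P" and "elements_mat P \<subseteq> floats p emax"
    and "T = tridiag 0 n \<alpha> \<beta> \<gamma>" and "elements_mat T \<subseteq> floats p emax"
    and "\<gamma> 1 \<in> floats p emax" and "\<beta> 1 \<in> floats p emax"
    and "\<And>j. j \<in> {1..n} \<Longrightarrow> \<beta> j \<noteq> 0"
    and "\<And>j. j \<in> {1..n} \<Longrightarrow> \<gamma> j > 0"
    and "\<And>j. j \<in> {1..n} \<Longrightarrow> within_exponent_range p emax ((\<gamma> j)\<^sup>2)"
    and "A = P * T * transpose_mat P"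
    and "v = \<gamma> 1 \<cdot>\<^sub>v (P *\<^sub>v unit_vec n 0)"
    and "w = \<beta> 1 \<cdot>\<^sub>v (P *\<^sub>v unit_vec n 0)"
  shows "computes_exactly fl ord A v w \<and> lanczos_T (fl, ord) A v w n = map_mat Some T"
proof -
  obtain \<tau> s where \<tau>: "\<tau> permutes {..<n}" and s: "\<And>k. s k = 1 \<or> s k = - 1"
    and P: "P = mat n n (\<lambda>(k, j). if j = \<tau> k then s k else 0)"
    using signed_permutation_mat_rows[OF assms(5)] by blast
  let ?F = "floats p emax" and ?t = "tridiag_fun \<alpha> \<beta> \<gamma>"
  have T_entry: "T $$ (i, j) = ?t i j" if "i < n" "j < n" for i j
    using that by (simp add: assms(7) tridiag_def tridiag_fun_def)
  have T_float: "?t i j \<in> ?F" if "i < n" "j < n" for i j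
  proof -
    have "T $$ (i, j) \<in> elements_mat T"
      using that by (intro elements_matI[of T n n i j]) (auto simp: assms(7) tridiag_def)
    then show ?thesis using assms(8) T_entry[OF that] by auto
  qed
  \<comment> \<open>The coefficients with index 1 do not occur in \<open>T\<close>.\<close>
  have beta_float: "\<beta> (Suc i) \<in> ?F" and gamma_float: "\<gamma> (Suc i) \<in> ?F" if "i < n" for i
  proof -
    show "\<beta> (Suc i) \<in> ?F"
    proof (cases i)
      case (Suc k)
      then show ?thesis using T_float[of k i] that by (simp add: tridiag_fun_def)
    qed (use assms(10) in simp)
    show "\<gamma> (Suc i) \<in> ?F"
    proof (cases i)
      case (Suc k)
      then show ?thesis using T_float[of i k] that by (simp add: tridiag_fun_def)
    qed (use assms(9) in simp)
  qed
  have pos: "\<beta> (Suc i) \<noteq> 0" "0 < \<gamma> (Suc i)" if "i < n" for i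
    using that assms(11,12)[of "Suc i"] by auto
  have fp: "tridiagonal_lanczos fl ord ?F n \<tau> s \<alpha> \<beta> \<gamma>"
  proof
    show "\<exists>r\<in>?F. 0 \<le> r \<and> fl ((\<gamma> (Suc i))\<^sup>2) = Some r \<and> fl (sqrt r) = Some (\<gamma> (Suc i))"
      if "i < n" for i
      using that assms(13)[of "Suc i"] gamma_float pos
      by (intro sqrt_round_square[OF assms(1,2)]) auto
  qed (use assms(3,4) \<tau> s T_float beta_float gamma_float pos in
      \<open>auto intro: round_exact_on_floats[OF assms(2)] zero_in_floats[OF assms(1)]
        one_in_floats[OF assms(1)] uminus_in_floats\<close>)
  have ex: "tridiagonal_lanczos Some ord UNIV n \<tau> s \<alpha> \<beta> \<gamma>"
    by standard (use assms(3,4) \<tau> s pos in \<open>auto simp: less_imp_le\<close>)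
  interpret tridiagonal_lanczos fl ord ?F n \<tau> s \<alpha> \<beta> \<gamma> by (rule fp)
  have "T \<in> carrier_mat n n" by (simp add: assms(7) tridiag_def)
  then have "A = mat n n (\<lambda>(k, l). s k * s l * T $$ (\<tau> k, \<tau> l))"
    using signed_permutation_mat_conjugate[OF \<tau> _ P] assms(14) by simp
  then have A: "map_mat Some A = M"
    using T_entry by (auto simp: transform_def)
  have start: "map_vec Some (c \<cdot>\<^sub>v (P *\<^sub>v unit_vec n 0)) = embed (\<lambda>k. c * unit_fun 0 k)" for c
  proof (rule eq_vecI)
    fix k assume "k < dim_vec (embed (\<lambda>k. c * unit_fun 0 k))"
    then have k: "k < n" by simp
    have "(P *\<^sub>v unit_vec n 0) $ k = s k * unit_fun 0 (\<tau> k)"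
      unfolding P using signed_permutation_mat_mult_vec[OF \<tau> k] k by (simp add: unit_fun_def)
    moreover have "dim_row P = n" by (simp add: P)
    ultimately show "map_vec Some (c \<cdot>\<^sub>v (P *\<^sub>v unit_vec n 0)) $ k = embed (\<lambda>k. c * unit_fun 0 k) $ k"
      using k by (simp add: embed_def)
  qed (simp add: P)
  have v: "map_vec Some v = embed (\<lambda>k. \<gamma> 1 * unit_fun 0 k)"
    and w: "map_vec Some w = embed (\<lambda>k. \<beta> 1 * unit_fun 0 k)"
    unfolding assms(15,16) by (rule start)+
  have "computes_exactly fl ord A v w"
    using fp ex A v w by (rule computes_exactly_if_same_data)
  moreover have "lanczos_T (fl, ord) A v w n = map_mat Some T"
    unfolding assms(7) using A v w by (rule lanczos_T_eq)
  ultimately show ?thesis by blast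
qed

end
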